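(* Let $X=\mathbb{R}/\mathbb{Z}$ and let $T:X\to X$, $T(x)=x+\alpha\pmod 1$, with $0<\alpha<1$ irrational. If $\alpha$ is of type $\gamma\ge1$, then $\underline{\mathcal{R}}(x,T)=1/\gamma$ for all $x\in X$.
   Context: For real $t$, $\Vert t\Vert=\min\{|t-p|:p\in\mathbb{Z}\}$; the metric on $X$ is $d(x,y)=\Vert x-y\Vert$. The number $\alpha$ is of type $\gamma$ if $\gamma=\sup\{\beta>0:\liminf_{k\to\infty}k^\beta\Vert k\alpha\Vert=0\}$ ($\gamma$ a finite real number). The return time is $\tau(x,r)=\inf\{k>0:d(x,T^kx)<r\}$ and the lower pointwise recurrence rate is $\underline{\mathcal{R}}(x,T)=\liminf_{r\to0}\frac{\log\tau(x,r)}{-\log r}$. *)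

theory Defs
  imports "HOL-Analysis.Analysis"
begin

definition dist_int :: "real \<Rightarrow> real"  (\<open>\<parallel>_\<parallel>\<close>)
  where "\<parallel>t\<parallel> = (INF p::int. \<bar>t - of_int p\<bar>)"

text \<open>The infimum is a minimum.\<close>

lemma dist_int_le: "\<parallel>t\<parallel> \<le> \<bar>t - of_int p\<bar>"
  unfolding dist_int_def by (rule cINF_lower) (auto intro!: bdd_belowI[where m = 0])

lemma dist_int_attained: "\<exists>p::int. \<parallel>t\<parallel> = \<bar>t - of_int p\<bar>"
proof
  have "\<bar>t - of_int (round t)\<bar> \<le> \<parallel>t\<parallel>"
    unfolding dist_int_def by (rule cINF_greatest) (auto intro: round_diff_minimal)
  then show "\<parallel>t\<parallel> = \<bar>t - of_int (round t)\<bar>"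
    using dist_int_le[of t "round t"] by linarith
qed

lemma dist_int_eq_0_iff: "\<parallel>t\<parallel> = 0 \<longleftrightarrow> t \<in> \<int>"
proof
  assume "\<parallel>t\<parallel> = 0"
  then show "t \<in> \<int>" using dist_int_attained[of t] by auto
next
  assume "t \<in> \<int>"
  then obtain p where "t = of_int p" by (auto elim: Ints_cases)
  then have "\<parallel>t\<parallel> \<le> 0" using dist_int_le[of t p] by simp
  moreover have "0 \<le> \<parallel>t\<parallel>" using dist_int_attained[of t] by auto
  ultimately show "\<parallel>t\<parallel> = 0" by simp
qed

lemma dist_int_minus_le: "\<parallel>- t\<parallel> \<le> \<parallel>t\<parallel>"
proof -
  obtain p where p: "\<parallel>t\<parallel> = \<bar>t - of_int p\<bar>" using dist_int_attained by blast
  have "\<parallel>- t\<parallel> \<le> \<bar>- t - of_int (- p)\<bar>" by (rule dist_int_le)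
  then show ?thesis unfolding p by simp
qed

lemma dist_int_minus: "\<parallel>- t\<parallel> = \<parallel>t\<parallel>"
  using dist_int_minus_le[of t] dist_int_minus_le[of "- t"] by simp

lemma dist_int_triangle: "\<parallel>s + t\<parallel> \<le> \<parallel>s\<parallel> + \<parallel>t\<parallel>"
proof -
  obtain p where p: "\<parallel>s\<parallel> = \<bar>s - of_int p\<bar>" using dist_int_attained by blast
  obtain q where q: "\<parallel>t\<parallel> = \<bar>t - of_int q\<bar>" using dist_int_attained by blast
  have "\<parallel>s + t\<parallel> \<le> \<bar>s + t - of_int (p + q)\<bar>" by (rule dist_int_le)
  then show ?thesis unfolding p q by simp
qed

lemma dist_int_cong: "s - t \<in> \<int> \<Longrightarrow> \<parallel>s\<parallel> = \<parallel>t\<parallel>"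
proof -
  assume *: "s - t \<in> \<int>"
  then have "t - s \<in> \<int>" using Ints_minus by fastforce
  with * show ?thesis
    using dist_int_triangle[of "s - t" t] dist_int_triangle[of "t - s" s]
      dist_int_eq_0_iff[of "s - t"] dist_int_eq_0_iff[of "t - s"] by simp
qed

quotient_type circle = real / "\<lambda>x y. x - y \<in> \<int>"
proof (rule equivpI)
  show "reflp (\<lambda>x y::real. x - y \<in> \<int>)" by (simp add: reflp_def)
  show "symp (\<lambda>x y::real. x - y \<in> \<int>)"
    by (metis (no_types, lifting) Ints_minus minus_diff_eq sympI)
  show "transp (\<lambda>x y::real. x - y \<in> \<int>)"
  proof (rule transpI)
    fix x y z :: real
    assume "x - y \<in> \<int>" "y - z \<in> \<int>"
    then have "(x - y) + (y - z) \<in> \<int>" by (rule Ints_add)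
    then show "x - z \<in> \<int>" by simp
  qed
qed

instantiation circle :: metric_space
begin

lift_definition dist_circle :: "circle \<Rightarrow> circle \<Rightarrow> real" is "\<lambda>x y. \<parallel>x - y\<parallel>"
proof -
  fix a b c d :: real
  assume "a - b \<in> \<int>" "c - d \<in> \<int>"
  then have "(a - b) - (c - d) \<in> \<int>" by (rule Ints_diff)
  then have "(a - c) - (b - d) \<in> \<int>" by (simp add: algebra_simps)
  then show "\<parallel>a - c\<parallel> = \<parallel>b - d\<parallel>" by (rule dist_int_cong)
qed

definition uniformity_circle :: "(circle \<times> circle) filter"
  where "uniformity_circle = (INF e\<in>{0<..}. principal {(x, y). dist x y < e})"

definition open_circle :: "circle set \<Rightarrow> bool"
  where "open_circle U \<longleftrightarrow> (\<forall>x\<in>U. eventually (\<lambda>(x', y). x' = x \<longrightarrow> y \<in> U) uniformity)"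

instance
proof
  show "dist x y = 0 \<longleftrightarrow> x = y" for x y :: circle
    by transfer (rule dist_int_eq_0_iff)
  show "dist x y \<le> dist x z + dist y z" for x y z :: circle
  proof transfer
    fix x y z :: real
    show "\<parallel>x - y\<parallel> \<le> \<parallel>x - z\<parallel> + \<parallel>y - z\<parallel>"
      using dist_int_triangle[of "x - z" "z - y"] dist_int_minus[of "y - z"] by simp
  qed
qed (simp_all add: uniformity_circle_def open_circle_def)

end

lift_definition rotation :: "real \<Rightarrow> circle \<Rightarrow> circle" is "\<lambda>\<alpha> x. x + \<alpha>"
  by simp

text \<open>The supremum is taken in the extended reals, so that no real number is a type of
  \<open>\<alpha>\<close> if the exponents are unbounded.\<close>

definition of_type :: "real \<Rightarrow> real \<Rightarrow> bool"
  where "of_type \<alpha> \<gamma> \<longleftrightarrow>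
    ereal \<gamma> = Sup (ereal ` {\<beta>. \<beta> > 0 \<and>
      liminf (\<lambda>k. ereal (real k powr \<beta> * \<parallel>real k * \<alpha>\<parallel>)) = 0})"

text \<open>The value is \<open>\<infinity>\<close> if \<open>x\<close> never returns.\<close>

definition return_time :: "('a::metric_space \<Rightarrow> 'a) \<Rightarrow> 'a \<Rightarrow> real \<Rightarrow> enat"
  where "return_time T x r = Inf (enat ` {k. k > 0 \<and> dist x ((T ^^ k) x) < r})"

definition ln_enat :: "enat \<Rightarrow> ereal"
  where "ln_enat n = (case n of enat m \<Rightarrow> ereal (ln (real m)) | \<infinity> \<Rightarrow> \<infinity>)"

definition lower_recurrence_rate :: "'a::metric_space \<Rightarrow> ('a \<Rightarrow> 'a) \<Rightarrow> ereal"
  where "lower_recurrence_rate x T =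
    Liminf (at_right 0) (\<lambda>r. ln_enat (return_time T x r) / ereal (- ln r))"

end

(* A rotation is an isometry, so d(x, T^k x) = ||k alpha|| for every x.  If k^b ||k alpha|| < 1 for
   infinitely many k, then the radii r = k^(-b) witness log tau(x, r) <= -(log r) / b for
   arbitrarily small r.  If k^b ||k alpha|| >= 1 for all large k, then k = tau(x, r), which is large
   for small r, satisfies 1 <= k^b ||k alpha|| < k^b r, so log tau(x, r) > -(log r) / b.  The
   first case covers all b < gamma, the second all b > gamma. *)
theory Submission
  imports Defs
begin

lemma return_time_le:
  assumes "k > 0" and "dist x ((T ^^ k) x) < r"
  shows "return_time T x r \<le> enat k"
  unfolding return_time_def using assms by (auto intro: Inf_lower)

text \<open>The infimum of a nonempty set of \<open>enat\<close> values is attained, since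
  \<open>enat\<close> is well-ordered. A finite infimum rules out the empty set, whose infimum is
  \<open>\<infinity>\<close>.\<close>

lemma return_time_eq_enatD:
  assumes "return_time T x r = enat k"
  shows "k > 0" and "dist x ((T ^^ k) x) < r"
proof -
  define A where "A = enat ` {k. k > 0 \<and> dist x ((T ^^ k) x) < r}"
  have "Inf A = enat k" using assms by (simp add: return_time_def A_def)
  moreover from this have "A \<noteq> {}" by (auto simp: top_enat_def)
  ultimately have "enat k \<in> A" by (metis Inf_enat_def LeastI ex_in_conv)
  then show "k > 0" and "dist x ((T ^^ k) x) < r" by (auto simp: A_def)
qed

lemma lower_recurrence_rate_le:
  assumes "\<beta> > 0"
    and freq: "\<exists>\<^sub>F k in sequentially. real k powr \<beta> * dist x ((T ^^ k) x) < 1"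
  shows "lower_recurrence_rate x T \<le> ereal (1 / \<beta>)"
proof (rule ccontr)
  assume "\<not> ?thesis"
  then have "ereal (1 / \<beta>) < lower_recurrence_rate x T" by simp
  then have ev: "\<forall>\<^sub>F r in at_right 0. ereal (1 / \<beta>) < ln_enat (return_time T x r) / ereal (- ln r)"
    unfolding lower_recurrence_rate_def by (rule less_LiminfD)
  have "((\<lambda>k. real k powr - \<beta>) \<longlongrightarrow> 0) sequentially"
    using \<open>\<beta> > 0\<close> by (intro tendsto_neg_powr filterlim_real_sequentially) auto
  \<comment> \<open>The radii must be positive to approach 0 from the right. This starts at k = 1,
    because \<open>0 powr - \<beta>\<close> is 0.\<close>
  then have "filterlim (\<lambda>k. real k powr - \<beta>) (at_right 0) sequentially"
    by (auto simp: filterlim_at intro: eventually_sequentiallyI[of 1])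
  with ev have "\<forall>\<^sub>F k in sequentially.
      ereal (1 / \<beta>) < ln_enat (return_time T x (real k powr - \<beta>)) / ereal (- ln (real k powr - \<beta>))"
    by (rule eventually_compose_filterlim)
  \<comment> \<open>From 2 on, ln k > 0, so the denominator -ln (k^(-\<beta>)) = \<beta> ln k is
    positive and the quotient can be compared with 1/\<beta>.\<close>
  moreover have "\<forall>\<^sub>F k::nat in sequentially. k \<ge> 2" by (rule eventually_ge_at_top)
  ultimately have "\<exists>\<^sub>F k in sequentially. False"
    using freq
  proof (elim frequently_rev_mp eventually_rev_mp, intro always_eventually allI impI)
    fix k :: nat
    assume k: "k \<ge> 2" and d: "real k powr \<beta> * dist x ((T ^^ k) x) < 1"
      and gt: "ereal (1 / \<beta>) < ln_enat (return_time T x (real k powr - \<beta>)) / ereal (- ln (real k powr - \<beta>))"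
    have "dist x ((T ^^ k) x) < real k powr - \<beta>"
      using d k by (simp add: powr_minus field_simps)
    with k have "return_time T x (real k powr - \<beta>) \<le> enat k" by (intro return_time_le) auto
    then obtain m where m: "return_time T x (real k powr - \<beta>) = enat m" "m \<le> k"
      by (cases "return_time T x (real k powr - \<beta>)") auto
    have "m > 0" using return_time_eq_enatD(1)[OF m(1)] .
    then have "ln (real m) \<le> ln (real k)" using m(2) by simp
    moreover have "ln (real k) > 0" using k by simp
    \<comment> \<open>The quotient equals ln m / (\<beta> ln k), which is at most 1/\<beta>, against
      \<open>gt\<close>.\<close>
    ultimately show False
      using gt m(1) k \<open>\<beta> > 0\<close> by (simp add: ln_enat_def ln_powr field_simps)
  qed
  then show False by simp
qed

text \<open>The bound \<open>ev\<close> controls only times from some K on. By aperiodicity the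
  finitely many earlier positive times have positive distances, so once r lies below all of these,
  the return time is at least K.\<close>

lemma lower_recurrence_rate_ge:
  assumes "\<beta> > 0"
    and aperiodic: "\<And>k. k > 0 \<Longrightarrow> (T ^^ k) x \<noteq> x"
    and ev: "\<forall>\<^sub>F k in sequentially. 1 \<le> real k powr \<beta> * dist x ((T ^^ k) x)"
  shows "ereal (1 / \<beta>) \<le> lower_recurrence_rate x T"
  unfolding lower_recurrence_rate_def
proof (rule Liminf_bounded)
  obtain K where K: "\<And>k. k \<ge> K \<Longrightarrow> 1 \<le> real k powr \<beta> * dist x ((T ^^ k) x)"
    using ev by (auto simp: eventually_sequentially)
  have "\<forall>\<^sub>F r in at_right 0. \<forall>k\<in>{0<..<K}. r < dist x ((T ^^ k) x)"
  proof (intro eventually_ball_finite ballI)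
    fix k assume "k \<in> {0<..<K}"
    then have "0 < dist x ((T ^^ k) x)" using aperiodic[of k] by (metis greaterThanLessThan_iff zero_less_dist_iff)
    then show "\<forall>\<^sub>F r in at_right 0. r < dist x ((T ^^ k) x)"
      by (rule order_tendstoD(2)[OF tendsto_ident_at])
  qed simp
  moreover have "\<forall>\<^sub>F r::real in at_right 0. r \<in> {0<..<1}"
    by (rule eventually_at_right_real) simp
  ultimately show "\<forall>\<^sub>F r in at_right 0.
      ereal (1 / \<beta>) \<le> ln_enat (return_time T x r) / ereal (- ln r)"
  proof eventually_elim
    fix r :: real
    assume small: "\<forall>k\<in>{0<..<K}. r < dist x ((T ^^ k) x)" and r: "r \<in> {0<..<1}"
    have "ln r < 0" using r by simp
    show "ereal (1 / \<beta>) \<le> ln_enat (return_time T x r) / ereal (- ln r)"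
    proof (cases "return_time T x r")
      case (enat k)
      note k = return_time_eq_enatD[OF enat]
      have "k \<ge> K" using k small by (metis greaterThanLessThan_iff not_less not_less_iff_gr_or_eq)
      then have "1 \<le> real k powr \<beta> * dist x ((T ^^ k) x)" by (rule K)
      also have "\<dots> < real k powr \<beta> * r" using k by simp
      \<comment> \<open>Taking logarithms turns the product into a sum; dividing by \<beta> and by
        -ln r > 0 then gives the bound on the quotient.\<close>
      finally have "0 < ln (real k powr \<beta> * r)" by simp
      also have "\<dots> = \<beta> * ln (real k) + ln r" using k r by (simp add: ln_mult ln_powr)
      finally show ?thesis
        using enat \<open>\<beta> > 0\<close> \<open>ln r < 0\<close> by (simp add: ln_enat_def field_simps)
    next
      case infinity
      then show ?thesis using \<open>ln r < 0\<close> by (simp add: ln_enat_def)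
    qed
  qed
qed

lemma dist_int_nonneg: "0 \<le> \<parallel>t\<parallel>"
  using dist_int_attained[of t] by auto

text \<open>Some exponent \<beta>' > \<beta> in the set has liminf 0, so its products drop below 1
  infinitely often. Lowering the exponent to \<beta> only decreases them, as k^\<beta> \<le>
  k^\<beta>' for k \<ge> 1.\<close>

lemma of_type_frequently:
  assumes "of_type \<alpha> \<gamma>" and "\<beta> < \<gamma>"
  shows "\<exists>\<^sub>F k in sequentially. real k powr \<beta> * \<parallel>real k * \<alpha>\<parallel> < 1"
proof -
  have "ereal \<beta> < Sup (ereal ` {\<beta>. \<beta> > 0 \<and>
      liminf (\<lambda>k. ereal (real k powr \<beta> * \<parallel>real k * \<alpha>\<parallel>)) = 0})"
    using assms by (simp add: of_type_def flip: less_ereal.simps(1))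
  then obtain \<beta>' where "\<beta> < \<beta>'"
    and lim: "liminf (\<lambda>k. ereal (real k powr \<beta>' * \<parallel>real k * \<alpha>\<parallel>)) = 0"
    by (auto simp: less_Sup_iff)
  have "\<exists>\<^sub>F k in sequentially. real k powr \<beta>' * \<parallel>real k * \<alpha>\<parallel> < 1"
  proof (rule ccontr)
    assume "\<not> ?thesis"
    then have "\<forall>\<^sub>F k in sequentially. 1 \<le> ereal (real k powr \<beta>' * \<parallel>real k * \<alpha>\<parallel>)"
      by (simp add: frequently_def not_less)
    then have "1 \<le> liminf (\<lambda>k. ereal (real k powr \<beta>' * \<parallel>real k * \<alpha>\<parallel>))"
      by (rule Liminf_bounded)
    with lim show False by simp
  qed
  then show ?thesis
  proof (rule frequently_mp[rotated])
    have "real k powr \<beta> * \<parallel>real k * \<alpha>\<parallel> < 1"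
      if "k \<ge> 1" and "real k powr \<beta>' * \<parallel>real k * \<alpha>\<parallel> < 1" for k
    proof -
      have "real k powr \<beta> * \<parallel>real k * \<alpha>\<parallel> \<le> real k powr \<beta>' * \<parallel>real k * \<alpha>\<parallel>"
        using that(1) \<open>\<beta> < \<beta>'\<close> by (intro mult_right_mono powr_mono dist_int_nonneg) auto
      with that(2) show ?thesis by simp
    qed
    then show "\<forall>\<^sub>F k in sequentially. real k powr \<beta>' * \<parallel>real k * \<alpha>\<parallel> < 1 \<longrightarrow>
        real k powr \<beta> * \<parallel>real k * \<alpha>\<parallel> < 1"
      by (intro eventually_sequentiallyI[of 1]) auto
  qed
qed

text \<open>A nonzero liminf gives only some positive lower bound c, perhaps below 1. It is
  therefore used at an exponent \<beta>' strictly between \<gamma> and \<beta>, and the spare factor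
  k^(\<beta> - \<beta>') eventually exceeds 1/c.\<close>

lemma of_type_eventually:
  assumes "of_type \<alpha> \<gamma>" and "0 \<le> \<gamma>" and "\<gamma> < \<beta>"
  shows "\<forall>\<^sub>F k in sequentially. 1 \<le> real k powr \<beta> * \<parallel>real k * \<alpha>\<parallel>"
proof -
  obtain \<beta>' where \<beta>': "\<gamma> < \<beta>'" "\<beta>' < \<beta>" using assms(3) dense by blast
  define L where "L = liminf (\<lambda>k. ereal (real k powr \<beta>' * \<parallel>real k * \<alpha>\<parallel>))"
  have "L \<noteq> 0"
  proof
    assume "L = 0"
    \<comment> \<open>Membership in the exponent set also demands \<beta>' > 0, which follows from 0
      \<le> \<gamma> < \<beta>'.\<close>
    then have "ereal \<beta>' \<le> ereal \<gamma>"
      using assms(1,2) \<beta>' unfolding of_type_def L_def by (auto intro!: Sup_upper)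
    with \<beta>' show False by simp
  qed
  moreover have "0 \<le> L" unfolding L_def
    by (intro Liminf_bounded always_eventually allI) (simp add: dist_int_nonneg)
  ultimately have "0 < L" by simp
  then obtain c where c: "0 < ereal c" "ereal c < L" using ereal_dense2 by blast
  have "\<forall>\<^sub>F k in sequentially. ereal c < ereal (real k powr \<beta>' * \<parallel>real k * \<alpha>\<parallel>)"
    using c(2) unfolding L_def by (rule less_LiminfD)
  moreover have "\<forall>\<^sub>F k in sequentially. real k powr - (\<beta> - \<beta>') < c"
  proof (rule order_tendstoD(2))
    show "((\<lambda>k. real k powr - (\<beta> - \<beta>')) \<longlongrightarrow> 0) sequentially"
      using \<beta>' by (intro tendsto_neg_powr filterlim_real_sequentially) auto
  qed (use c in simp)
  moreover have "\<forall>\<^sub>F k::nat in sequentially. k \<ge> 1" by (rule eventually_ge_at_top)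
  ultimately show ?thesis
  proof eventually_elim
    case (elim k)
    have "1 = real k powr \<beta> * real k powr - \<beta>" using elim(3) by (simp flip: powr_add)
    also have "\<dots> = real k powr \<beta> * (real k powr - \<beta>' * real k powr - (\<beta> - \<beta>'))"
      by (simp flip: powr_add)
    \<comment> \<open>The replaced factor \<open>real k powr - (\<beta> - \<beta>')\<close> is below
      c, and c is below the new one.\<close>
    also have "\<dots> \<le> real k powr \<beta> * (real k powr - \<beta>' * (real k powr \<beta>' * \<parallel>real k * \<alpha>\<parallel>))"
      using elim by (intro mult_left_mono) auto
    also have "\<dots> = real k powr \<beta> * \<parallel>real k * \<alpha>\<parallel>"
      using elim(3) by (simp add: powr_minus)
    finally show ?case .
  qed
qed

lemma dist_rotation_funpow: "dist x ((rotation \<alpha> ^^ k) x) = \<parallel>real k * \<alpha>\<parallel>"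
proof -
  have "(rotation \<alpha> ^^ k) x = rotation (real k * \<alpha>) x"
  proof (induction k)
    case 0
    show ?case by simp (transfer, simp)
  next
    case (Suc k)
    then show ?case by simp (transfer, simp add: algebra_simps)
  qed
  moreover have "dist x (rotation \<theta> x) = \<parallel>\<theta>\<parallel>" for \<theta>
    by transfer (simp add: dist_int_minus)
  ultimately show ?thesis by simp
qed

theorem theorem8:
  fixes \<alpha> \<gamma> :: real
  assumes "0 < \<alpha>" and "\<alpha> < 1" and "\<alpha> \<notin> \<rat>"
    and "of_type \<alpha> \<gamma>" and "\<gamma> \<ge> 1"
  shows "\<forall>x::circle. lower_recurrence_rate x (rotation \<alpha>) = ereal (1 / \<gamma>)"
proof
  fix x :: circle
  \<comment> \<open>The two bounds hold for \<beta> on either side of \<gamma>, not at \<gamma>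
    itself. Continuity of 1/\<beta> at \<gamma> \<noteq> 0 carries them over; a general
    \<open>S\<close> serves both one-sided limits.\<close>
  have lim: "((\<lambda>\<beta>. ereal (1 / \<beta>)) \<longlongrightarrow> ereal (1 / \<gamma>)) (at \<gamma> within S)" for S
    using assms(5) by (intro tendsto_intros) auto
  have aperiodic: "(rotation \<alpha> ^^ k) x \<noteq> x" if "k > 0" for k
  proof
    assume "(rotation \<alpha> ^^ k) x = x"
    \<comment> \<open>A periodic point would make k\<alpha> an integer, hence \<alpha>
      rational.\<close>
    then have "\<parallel>real k * \<alpha>\<parallel> = 0" by (simp flip: dist_rotation_funpow[of x])
    then have "real k * \<alpha> / real k \<in> \<rat>"
      by (intro Rats_divide) (auto simp: dist_int_eq_0_iff elim: Ints_cases)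
    with that assms(3) show False by simp
  qed
  show "lower_recurrence_rate x (rotation \<alpha>) = ereal (1 / \<gamma>)"
  proof (rule antisym)
    show "lower_recurrence_rate x (rotation \<alpha>) \<le> ereal (1 / \<gamma>)"
    proof (rule tendsto_lowerbound[OF lim])
      have "\<forall>\<^sub>F \<beta> in at_left \<gamma>. \<beta> \<in> {0<..<\<gamma>}"
        using assms(5) by (intro eventually_at_left_real) simp
      then show "\<forall>\<^sub>F \<beta> in at_left \<gamma>. lower_recurrence_rate x (rotation \<alpha>) \<le> ereal (1 / \<beta>)"
      proof eventually_elim
        case (elim \<beta>)
        then show ?case
          using assms(4)
          by (intro lower_recurrence_rate_le)
            (auto simp: dist_rotation_funpow intro: of_type_frequently)
      qed
    qed simp
    show "ereal (1 / \<gamma>) \<le> lower_recurrence_rate x (rotation \<alpha>)"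
    proof (rule tendsto_upperbound[OF lim])
      \<comment> \<open>The endpoint \<gamma> + 1 is an arbitrary choice; only \<beta> > \<gamma>
        matters.\<close>
      have "\<forall>\<^sub>F \<beta> in at_right \<gamma>. \<beta> \<in> {\<gamma><..<\<gamma> + 1}"
        by (intro eventually_at_right_real) simp
      then show "\<forall>\<^sub>F \<beta> in at_right \<gamma>. ereal (1 / \<beta>) \<le> lower_recurrence_rate x (rotation \<alpha>)"
      proof eventually_elim
        case (elim \<beta>)
        then show ?case
          using assms(4,5) aperiodic
          by (intro lower_recurrence_rate_ge)
            (auto simp: dist_rotation_funpow intro: of_type_eventually)
      qed
    qed simp
  qed
qed

end
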